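(* Let $\mathcal{C}$ be a category with finite products and let $S,A\in\mathcal{C}$. Let $\mathrm{Get}:S\to A$ and $\mathrm{Put}:S\times A\to S$ be morphisms (a concrete lens), with corresponding optic $p=\langle[\mathrm{id}_S,\mathrm{Get}]\mid\mathrm{Put}\rangle:S\to A$. Then $p$ is lawful if and only if the following three concrete lens laws hold: (PutGet) $\mathrm{Get}\circ\mathrm{Put}=\pi_2:S\times A\to A$; (GetPut) $\mathrm{Put}\circ[\mathrm{id}_S,\mathrm{Get}]=\mathrm{id}_S$; (PutPut) $\mathrm{Put}\circ(\mathrm{Put}\times A)=\mathrm{Put}\circ\pi_{1,3}:S\times A\times A\to S$.
   Context: $[f,g]:X\to Y\times Z$ is the pairing of $f:X\to Y$ and $g:X\to Z$; $\pi_{1,3}:S\times A\times A\to S\times A$ projects to the first and third factors; an object in place of a morphism denotes its identity; $;$ denotes composition in diagrammatic order. Here $\mathcal{C}$ is monoidal under $\times$ and acts on itself by $M\cdot A=M\times A$; associativity isomorphisms are suppressed. An optic $S\to A$ (short for $(S,S)\to(A,A)$) is an element $\langle l\mid r\rangle$ of $\mathbf{Optic}_\times(S,A):=\int^{M\in\mathcal{C}}\mathcal{C}(S,M\times A)\times\mathcal{C}(M\times A,S)$, i.e. a pair $l:S\to M\times A$, $r:M\times A\to S$ (for some $M$), modulo the equivalence relation generated by $\langle l;(\phi\times A)\mid r\rangle=\langle l\mid(\phi\times A);r\rangle$. $\mathbf{Optic}^2_\times(S,A):=\int^{M_1,M_2\in\mathcal{C}}\mathcal{C}(S,M_1\times A)\times\mathcal{C}(M_1\times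 A,M_2\times A)\times\mathcal{C}(M_2\times A,S)$, i.e. triples $\langle l\mid c\mid r\rangle$ modulo the relations generated by $\langle l;(\phi\times A)\mid c\mid r\rangle=\langle l\mid(\phi\times A);c\mid r\rangle$ and $\langle l\mid c;(\phi\times A)\mid r\rangle=\langle l\mid c\mid(\phi\times A);r\rangle$. Define $\mathsf{outside}(\langle l\mid r\rangle)=l;r\in\mathcal{C}(S,S)$, and in $\mathbf{Optic}^2_\times(S,A)$, $\mathsf{once}(\langle l\mid r\rangle)=\langle l\mid\mathrm{id}_{M\times A}\mid r\rangle$ and $\mathsf{twice}(\langle l\mid r\rangle)=\langle l\mid r;l\mid r\rangle$. These are well defined. An optic $p:S\to A$ is lawful if $\mathsf{outside}(p)=\mathrm{id}_S$ and $\mathsf{once}(p)=\mathsf{twice}(p)$. *)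

theory Defs
  imports Main
begin

record ('o, 'm) category =
  Obj :: "'o set"
  Arr :: "'m set"
  src :: "'m \<Rightarrow> 'o"
  tgt :: "'m \<Rightarrow> 'o"
  ident :: "'o \<Rightarrow> 'm"
  seq :: "'m \<Rightarrow> 'm \<Rightarrow> 'm"  (infixr \<open>\<Zsemi>\<index>\<close> 55)  \<comment> \<open>diagrammatic order\<close>

definition hom :: "('o, 'm, 'x) category_scheme \<Rightarrow> 'o \<Rightarrow> 'o \<Rightarrow> 'm set" where
  "hom C X Y = {f \<in> Arr C. src C f = X \<and> tgt C f = Y}"

locale category =
  fixes C :: "('o, 'm, 'x) category_scheme" (structure)
  assumes src_Obj: "f \<in> Arr C \<Longrightarrow> src C f \<in> Obj C"
    and tgt_Obj: "f \<in> Arr C \<Longrightarrow> tgt C f \<in> Obj C"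
    and ident_hom: "X \<in> Obj C \<Longrightarrow> ident C X \<in> hom C X X"
    and seq_hom: "\<lbrakk>f \<in> hom C X Y; g \<in> hom C Y Z\<rbrakk> \<Longrightarrow> f \<Zsemi> g \<in> hom C X Z"
    and ident_seq: "f \<in> hom C X Y \<Longrightarrow> ident C X \<Zsemi> f = f"
    and seq_ident: "f \<in> hom C X Y \<Longrightarrow> f \<Zsemi> ident C Y = f"
    and seq_assoc: "\<lbrakk>f \<in> hom C W X; g \<in> hom C X Y; h \<in> hom C Y Z\<rbrakk>
      \<Longrightarrow> (f \<Zsemi> g) \<Zsemi> h = f \<Zsemi> (g \<Zsemi> h)"

text \<open>
  The monoidal structure given by the product depends on a choice of products, which is
  therefore part of the structure; it is only required to satisfy the universal properties.
\<close>

record ('o, 'm) fp_category = "('o, 'm) category" +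
  unit_obj :: 'o
  prod_obj :: "'o \<Rightarrow> 'o \<Rightarrow> 'o"  (infixl \<open>\<otimes>\<index>\<close> 65)
  proj1 :: "'o \<Rightarrow> 'o \<Rightarrow> 'm"
  proj2 :: "'o \<Rightarrow> 'o \<Rightarrow> 'm"

locale finite_product_category = category C
  for C :: "('o, 'm, 'x) fp_category_scheme" (structure) +
  assumes unit_Obj: "unit_obj C \<in> Obj C"
    and unit_terminal: "X \<in> Obj C \<Longrightarrow> \<exists>!f. f \<in> hom C X (unit_obj C)"
    and prod_Obj: "\<lbrakk>Y \<in> Obj C; Z \<in> Obj C\<rbrakk> \<Longrightarrow> Y \<otimes> Z \<in> Obj C"
    and proj1_hom: "\<lbrakk>Y \<in> Obj C; Z \<in> Obj C\<rbrakk> \<Longrightarrow> proj1 C Y Z \<in> hom C (Y \<otimes> Z) Y"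
    and proj2_hom: "\<lbrakk>Y \<in> Obj C; Z \<in> Obj C\<rbrakk> \<Longrightarrow> proj2 C Y Z \<in> hom C (Y \<otimes> Z) Z"
    and prod_universal: "\<lbrakk>f \<in> hom C X Y; g \<in> hom C X Z\<rbrakk>
      \<Longrightarrow> \<exists>!h. h \<in> hom C X (Y \<otimes> Z) \<and> h \<Zsemi> proj1 C Y Z = f \<and> h \<Zsemi> proj2 C Y Z = g"

definition pair :: "('o, 'm, 'x) fp_category_scheme \<Rightarrow> 'm \<Rightarrow> 'm \<Rightarrow> 'm" where
  "pair C f g = (THE h. h \<in> hom C (src C f) (prod_obj C (tgt C f) (tgt C g)) \<and>
     seq C h (proj1 C (tgt C f) (tgt C g)) = f \<and>
     seq C h (proj2 C (tgt C f) (tgt C g)) = g)"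

definition prod_arr :: "('o, 'm, 'x) fp_category_scheme \<Rightarrow> 'm \<Rightarrow> 'm \<Rightarrow> 'm" where
  "prod_arr C f g = pair C
     (seq C (proj1 C (src C f) (src C g)) f)
     (seq C (proj2 C (src C f) (src C g)) g)"

definition act :: "('o, 'm, 'x) fp_category_scheme \<Rightarrow> 'm \<Rightarrow> 'o \<Rightarrow> 'm" where
  "act C \<phi> A = prod_arr C \<phi> (ident C A)"

text \<open>
  The coends are realised as quotients of the sets of representatives, which carry their
  residual objects \<open>M\<close>, by the equivalence relations generated by the sliding steps.
\<close>

definition optic_reps ::
  "('o, 'm, 'x) fp_category_scheme \<Rightarrow> 'o \<Rightarrow> 'o \<Rightarrow> ('o \<times> 'm \<times> 'm) set" where
  "optic_reps C S A = {(M, l, r). M \<in> Obj C \<and>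
     l \<in> hom C S (prod_obj C M A) \<and> r \<in> hom C (prod_obj C M A) S}"

inductive optic_step ::
  "('o, 'm, 'x) fp_category_scheme \<Rightarrow> 'o \<Rightarrow> 'o \<Rightarrow> 'o \<times> 'm \<times> 'm \<Rightarrow> 'o \<times> 'm \<times> 'm \<Rightarrow> bool"
  for C (structure) and S A where
  "\<lbrakk>M \<in> Obj C; N \<in> Obj C; \<phi> \<in> hom C M N; l \<in> hom C S (M \<otimes> A); r \<in> hom C (N \<otimes> A) S\<rbrakk>
    \<Longrightarrow> optic_step C S A (N, l \<Zsemi> act C \<phi> A, r) (M, l, act C \<phi> A \<Zsemi> r)"

definition optic_rel ::
  "('o, 'm, 'x) fp_category_scheme \<Rightarrow> 'o \<Rightarrow> 'o \<Rightarrow> (('o \<times> 'm \<times> 'm) \<times> ('o \<times> 'm \<times> 'm)) set" where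
  "optic_rel C S A = {(x, y). x \<in> optic_reps C S A \<and> y \<in> optic_reps C S A \<and>
     equivclp (optic_step C S A) x y}"

definition Optic ::
  "('o, 'm, 'x) fp_category_scheme \<Rightarrow> 'o \<Rightarrow> 'o \<Rightarrow> ('o \<times> 'm \<times> 'm) set set" where
  "Optic C S A = optic_reps C S A // optic_rel C S A"

definition optic ::
  "('o, 'm, 'x) fp_category_scheme \<Rightarrow> 'o \<Rightarrow> 'o \<Rightarrow> 'o \<Rightarrow> 'm \<Rightarrow> 'm \<Rightarrow> ('o \<times> 'm \<times> 'm) set" where
  "optic C S A M l r = optic_rel C S A `` {(M, l, r)}"

definition optic2_reps ::
  "('o, 'm, 'x) fp_category_scheme \<Rightarrow> 'o \<Rightarrow> 'o \<Rightarrow> ('o \<times> 'o \<times> 'm \<times> 'm \<times> 'm) set" where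
  "optic2_reps C S A = {(M1, M2, l, c, r). M1 \<in> Obj C \<and> M2 \<in> Obj C \<and>
     l \<in> hom C S (prod_obj C M1 A) \<and>
     c \<in> hom C (prod_obj C M1 A) (prod_obj C M2 A) \<and>
     r \<in> hom C (prod_obj C M2 A) S}"

inductive optic2_step ::
  "('o, 'm, 'x) fp_category_scheme \<Rightarrow> 'o \<Rightarrow> 'o \<Rightarrow>
    'o \<times> 'o \<times> 'm \<times> 'm \<times> 'm \<Rightarrow> 'o \<times> 'o \<times> 'm \<times> 'm \<times> 'm \<Rightarrow> bool"
  for C (structure) and S A where
  slide_left: "\<lbrakk>M1 \<in> Obj C; N1 \<in> Obj C; M2 \<in> Obj C; \<phi> \<in> hom C M1 N1;
      l \<in> hom C S (M1 \<otimes> A); c \<in> hom C (N1 \<otimes> A) (M2 \<otimes> A); r \<in> hom C (M2 \<otimes> A) S\<rbrakk>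
    \<Longrightarrow> optic2_step C S A (N1, M2, l \<Zsemi> act C \<phi> A, c, r) (M1, M2, l, act C \<phi> A \<Zsemi> c, r)"
| slide_right: "\<lbrakk>M1 \<in> Obj C; M2 \<in> Obj C; N2 \<in> Obj C; \<phi> \<in> hom C M2 N2;
      l \<in> hom C S (M1 \<otimes> A); c \<in> hom C (M1 \<otimes> A) (M2 \<otimes> A); r \<in> hom C (N2 \<otimes> A) S\<rbrakk>
    \<Longrightarrow> optic2_step C S A (M1, N2, l, c \<Zsemi> act C \<phi> A, r) (M1, M2, l, c, act C \<phi> A \<Zsemi> r)"

definition optic2_rel ::
  "('o, 'm, 'x) fp_category_scheme \<Rightarrow> 'o \<Rightarrow> 'o \<Rightarrow>
    (('o \<times> 'o \<times> 'm \<times> 'm \<times> 'm) \<times> ('o \<times> 'o \<times> 'm \<times> 'm \<times> 'm)) set" where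
  "optic2_rel C S A = {(x, y). x \<in> optic2_reps C S A \<and> y \<in> optic2_reps C S A \<and>
     equivclp (optic2_step C S A) x y}"

definition Optic2 ::
  "('o, 'm, 'x) fp_category_scheme \<Rightarrow> 'o \<Rightarrow> 'o \<Rightarrow> ('o \<times> 'o \<times> 'm \<times> 'm \<times> 'm) set set" where
  "Optic2 C S A = optic2_reps C S A // optic2_rel C S A"

definition optic2 ::
  "('o, 'm, 'x) fp_category_scheme \<Rightarrow> 'o \<Rightarrow> 'o \<Rightarrow> 'o \<Rightarrow> 'o \<Rightarrow> 'm \<Rightarrow> 'm \<Rightarrow> 'm \<Rightarrow>
    ('o \<times> 'o \<times> 'm \<times> 'm \<times> 'm) set" where
  "optic2 C S A M1 M2 l c r = optic2_rel C S A `` {(M1, M2, l, c, r)}"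

text \<open>
  The next three maps are defined on classes by mapping all representatives and taking the
  unique element of the image; that it is unique is proved below.
\<close>

definition outside :: "('o, 'm, 'x) fp_category_scheme \<Rightarrow> ('o \<times> 'm \<times> 'm) set \<Rightarrow> 'm" where
  "outside C p = the_elem ((\<lambda>(M, l, r). seq C l r) ` p)"

definition once :: "('o, 'm, 'x) fp_category_scheme \<Rightarrow> 'o \<Rightarrow> 'o \<Rightarrow>
    ('o \<times> 'm \<times> 'm) set \<Rightarrow> ('o \<times> 'o \<times> 'm \<times> 'm \<times> 'm) set" where
  "once C S A p =
     the_elem ((\<lambda>(M, l, r). optic2 C S A M M l (ident C (prod_obj C M A)) r) ` p)"

definition twice :: "('o, 'm, 'x) fp_category_scheme \<Rightarrow> 'o \<Rightarrow> 'o \<Rightarrow>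
    ('o \<times> 'm \<times> 'm) set \<Rightarrow> ('o \<times> 'o \<times> 'm \<times> 'm \<times> 'm) set" where
  "twice C S A p =
     the_elem ((\<lambda>(M, l, r). optic2 C S A M M l (seq C r l) r) ` p)"

definition lawful_optic ::
  "('o, 'm, 'x) fp_category_scheme \<Rightarrow> 'o \<Rightarrow> 'o \<Rightarrow> ('o \<times> 'm \<times> 'm) set \<Rightarrow> bool" where
  "lawful_optic C S A p \<longleftrightarrow> p \<in> Optic C S A \<and>
     outside C p = ident C S \<and> once C S A p = twice C S A p"

definition lens_optic ::
  "('o, 'm, 'x) fp_category_scheme \<Rightarrow> 'o \<Rightarrow> 'o \<Rightarrow> 'm \<Rightarrow> 'm \<Rightarrow> ('o \<times> 'm \<times> 'm) set" where
  "lens_optic C S A Get Put = optic C S A S (pair C (ident C S) Get) Put"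

context finite_product_category
begin

lemma hom_Obj:
  assumes "f \<in> hom C X Y"
  shows "X \<in> Obj C" "Y \<in> Obj C"
  using assms src_Obj tgt_Obj by (auto simp: hom_def)

lemma pair_props:
  assumes "f \<in> hom C X Y" "g \<in> hom C X Z"
  shows "pair C f g \<in> hom C X (Y \<otimes> Z)"
    and "pair C f g \<Zsemi> proj1 C Y Z = f"
    and "pair C f g \<Zsemi> proj2 C Y Z = g"
proof -
  have eq: "src C f = X" "tgt C f = Y" "tgt C g = Z"
    using assms by (auto simp: hom_def)
  have "pair C f g \<in> hom C X (Y \<otimes> Z) \<and>
      pair C f g \<Zsemi> proj1 C Y Z = f \<and> pair C f g \<Zsemi> proj2 C Y Z = g"
    unfolding pair_def eq by (rule theI') (rule prod_universal [OF assms])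
  then show "pair C f g \<in> hom C X (Y \<otimes> Z)"
    and "pair C f g \<Zsemi> proj1 C Y Z = f"
    and "pair C f g \<Zsemi> proj2 C Y Z = g"
    by auto
qed

lemma prod_arr_hom:
  assumes "f \<in> hom C W X" "g \<in> hom C Y Z"
  shows "prod_arr C f g \<in> hom C (W \<otimes> Y) (X \<otimes> Z)"
proof -
  have eq: "src C f = W" "src C g = Y"
    using assms by (auto simp: hom_def)
  note ob = hom_Obj [OF assms(1)] hom_Obj [OF assms(2)]
  show ?thesis
    unfolding prod_arr_def eq
    by (rule pair_props(1) [OF seq_hom [OF proj1_hom [OF ob(1,3)] assms(1)]
          seq_hom [OF proj2_hom [OF ob(1,3)] assms(2)]])
qed

lemma act_hom: "\<lbrakk>\<phi> \<in> hom C M N; A \<in> Obj C\<rbrakk> \<Longrightarrow> act C \<phi> A \<in> hom C (M \<otimes> A) (N \<otimes> A)"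
  unfolding act_def by (rule prod_arr_hom) (auto intro: ident_hom)

lemma equiv_optic_rel: "equiv (optic_reps C S A) (optic_rel C S A)"
proof (rule equivI)
  show "optic_rel C S A \<subseteq> optic_reps C S A \<times> optic_reps C S A"
    by (auto simp: optic_rel_def)
  show "refl_on (optic_reps C S A) (optic_rel C S A)"
    by (simp add: optic_rel_def refl_on_def)
  show "sym (optic_rel C S A)"
    unfolding optic_rel_def by (rule symI) (blast dest: equivclp_sym)
  show "trans (optic_rel C S A)"
    unfolding optic_rel_def by (rule transI) (blast dest: equivclp_trans)
qed

lemma equiv_optic2_rel: "equiv (optic2_reps C S A) (optic2_rel C S A)"
proof (rule equivI)
  show "optic2_rel C S A \<subseteq> optic2_reps C S A \<times> optic2_reps C S A"
    by (auto simp: optic2_rel_def)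
  show "refl_on (optic2_reps C S A) (optic2_rel C S A)"
    by (simp add: optic2_rel_def refl_on_def)
  show "sym (optic2_rel C S A)"
    unfolding optic2_rel_def by (rule symI) (blast dest: equivclp_sym)
  show "trans (optic2_rel C S A)"
    unfolding optic2_rel_def by (rule transI) (blast dest: equivclp_trans)
qed

lemma optic_in_Optic: "(M, l, r) \<in> optic_reps C S A \<Longrightarrow> optic C S A M l r \<in> Optic C S A"
  unfolding optic_def Optic_def by (rule quotientI)

lemma lift_class:
  assumes rep: "(M, l, r) \<in> optic_reps C S A"
    and step: "\<And>x y. optic_step C S A x y \<Longrightarrow> F x = F y"
  shows "the_elem (F ` optic C S A M l r) = F (M, l, r)"
proof -
  have inv: "F x = F y" if "equivclp (optic_step C S A) x y" for x y
    using that
  proof (induction rule: equivclp_induct)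
    case (step y z)
    then show ?case
      using assms(2) [of y z] assms(2) [of z y] by metis
  qed simp
  have mem: "(M, l, r) \<in> optic C S A M l r"
    using rep by (simp add: optic_def optic_rel_def)
  have const: "F x = F (M, l, r)" if "x \<in> optic C S A M l r" for x
    by (rule inv [symmetric]) (use that in \<open>simp add: optic_def optic_rel_def\<close>)
  have "F ` optic C S A M l r = {F (M, l, r)}"
  proof (intro equalityI subsetI)
    fix z assume "z \<in> F ` optic C S A M l r"
    then show "z \<in> {F (M, l, r)}"
      using const by (metis imageE singletonI)
  next
    fix z assume "z \<in> {F (M, l, r)}"
    then show "z \<in> F ` optic C S A M l r"
      using imageI [OF mem, of F] by simp
  qed
  then show ?thesis
    by simp
qed

lemma outside_optic:
  assumes "A \<in> Obj C" "(M, l, r) \<in> optic_reps C S A"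
  shows "outside C (optic C S A M l r) = l \<Zsemi> r"
proof -
  have "(\<lambda>(M, l, r). l \<Zsemi> r) x = (\<lambda>(M, l, r). l \<Zsemi> r) y" if "optic_step C S A x y" for x y
    using that
  proof cases
    case (1 M N \<phi> l r)
    then show ?thesis
      using seq_assoc [OF 1(6) act_hom [OF 1(5) assms(1)] 1(7)] by (simp add: 1(1,2))
  qed
  from lift_class [OF assms(2), of "\<lambda>(M, l, r). l \<Zsemi> r", OF this] show ?thesis
    by (simp add: outside_def)
qed

lemma optic2_eqI:
  assumes "x = (M1, M2, l, c, r)" "y = (N1, N2, l', c', r')"
    and "x \<in> optic2_reps C S A" "y \<in> optic2_reps C S A"
    and "optic2_step C S A x y"
  shows "optic2 C S A M1 M2 l c r = optic2 C S A N1 N2 l' c' r'"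
  unfolding optic2_def
proof (rule equiv_class_eq [OF equiv_optic2_rel])
  show "((M1, M2, l, c, r), (N1, N2, l', c', r')) \<in> optic2_rel C S A"
    using assms by (auto simp: optic2_rel_def)
qed

lemma optic2_slide_left:
  assumes "A \<in> Obj C" "\<phi> \<in> hom C M1 N1" "M2 \<in> Obj C" "l \<in> hom C S (M1 \<otimes> A)"
    "c \<in> hom C (N1 \<otimes> A) (M2 \<otimes> A)" "r \<in> hom C (M2 \<otimes> A) S"
  shows "optic2 C S A N1 M2 (l \<Zsemi> act C \<phi> A) c r = optic2 C S A M1 M2 l (act C \<phi> A \<Zsemi> c) r"
proof (rule optic2_eqI [OF refl refl])
  note a = act_hom [OF assms(2,1)] and ob = hom_Obj [OF assms(2)]
  note b = seq_hom [OF assms(4) a] seq_hom [OF a assms(5)]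
  show "(N1, M2, l \<Zsemi> act C \<phi> A, c, r) \<in> optic2_reps C S A" using assms ob b by (simp add: optic2_reps_def)
  show "(M1, M2, l, act C \<phi> A \<Zsemi> c, r) \<in> optic2_reps C S A" using assms ob b by (simp add: optic2_reps_def)
  show "optic2_step C S A (N1, M2, l \<Zsemi> act C \<phi> A, c, r) (M1, M2, l, act C \<phi> A \<Zsemi> c, r)" using assms ob by (simp add: optic2_step.slide_left)
qed

lemma optic2_slide_right:
  assumes "A \<in> Obj C" "\<phi> \<in> hom C M2 N2" "M1 \<in> Obj C" "l \<in> hom C S (M1 \<otimes> A)"
    "c \<in> hom C (M1 \<otimes> A) (M2 \<otimes> A)" "r \<in> hom C (N2 \<otimes> A) S"
  shows "optic2 C S A M1 N2 l (c \<Zsemi> act C \<phi> A) r = optic2 C S A M1 M2 l c (act C \<phi> A \<Zsemi> r)"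
proof (rule optic2_eqI [OF refl refl])
  note a = act_hom [OF assms(2,1)] and ob = hom_Obj [OF assms(2)]
  note b = seq_hom [OF assms(5) a] seq_hom [OF a assms(6)]
  show "(M1, N2, l, c \<Zsemi> act C \<phi> A, r) \<in> optic2_reps C S A" using assms ob b by (simp add: optic2_reps_def)
  show "(M1, M2, l, c, act C \<phi> A \<Zsemi> r) \<in> optic2_reps C S A" using assms ob b by (simp add: optic2_reps_def)
  show "optic2_step C S A (M1, N2, l, c \<Zsemi> act C \<phi> A, r) (M1, M2, l, c, act C \<phi> A \<Zsemi> r)" using assms ob by (simp add: optic2_step.slide_right)
qed

lemma once_optic:
  assumes A: "A \<in> Obj C" and rep: "(M, l, r) \<in> optic_reps C S A"
  shows "once C S A (optic C S A M l r) = optic2 C S A M M l (ident C (M \<otimes> A)) r"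
proof -
  let ?F = "\<lambda>(M, l, r). optic2 C S A M M l (ident C (M \<otimes> A)) r"
  have "?F x = ?F y" if "optic_step C S A x y" for x y
    using that
  proof cases
    case (1 M N \<phi> l r)
    note a = act_hom [OF 1(5) A]
    note i = ident_hom [OF prod_Obj [OF 1(3) A]] ident_hom [OF prod_Obj [OF 1(4) A]]
    have "optic2 C S A N N (l \<Zsemi> act C \<phi> A) (ident C (N \<otimes> A)) r
        = optic2 C S A M N l (ident C (M \<otimes> A) \<Zsemi> act C \<phi> A) r"
      using optic2_slide_left [OF A 1(5) 1(4) 1(6) i(2) 1(7)] a
      by (simp add: ident_seq seq_ident)
    also have "\<dots> = optic2 C S A M M l (ident C (M \<otimes> A)) (act C \<phi> A \<Zsemi> r)"
      by (rule optic2_slide_right [OF A 1(5) 1(3) 1(6) i(1) 1(7)])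
    finally show ?thesis
      by (simp add: 1(1,2))
  qed
  from lift_class [OF rep, of ?F, OF this] show ?thesis
    by (simp add: once_def)
qed

lemma twice_optic:
  assumes A: "A \<in> Obj C" and rep: "(M, l, r) \<in> optic_reps C S A"
  shows "twice C S A (optic C S A M l r) = optic2 C S A M M l (r \<Zsemi> l) r"
proof -
  let ?F = "\<lambda>(M, l, r). optic2 C S A M M l (r \<Zsemi> l) r"
  have "?F x = ?F y" if "optic_step C S A x y" for x y
    using that
  proof cases
    case (1 M N \<phi> l r)
    note a = act_hom [OF 1(5) A]
    have "optic2 C S A N N (l \<Zsemi> act C \<phi> A) (r \<Zsemi> (l \<Zsemi> act C \<phi> A)) r
        = optic2 C S A M N l (act C \<phi> A \<Zsemi> (r \<Zsemi> (l \<Zsemi> act C \<phi> A))) r"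
      by (rule optic2_slide_left [OF A 1(5) 1(4) 1(6) seq_hom [OF 1(7) seq_hom [OF 1(6) a]] 1(7)])
    also have "act C \<phi> A \<Zsemi> (r \<Zsemi> (l \<Zsemi> act C \<phi> A)) = ((act C \<phi> A \<Zsemi> r) \<Zsemi> l) \<Zsemi> act C \<phi> A"
      using seq_assoc [OF a 1(7) seq_hom [OF 1(6) a]]
        seq_assoc [OF seq_hom [OF a 1(7)] 1(6) a] by simp
    also have "optic2 C S A M N l \<dots> r
        = optic2 C S A M M l ((act C \<phi> A \<Zsemi> r) \<Zsemi> l) (act C \<phi> A \<Zsemi> r)"
      by (rule optic2_slide_right [OF A 1(5) 1(3) 1(6) seq_hom [OF seq_hom [OF a 1(7)] 1(6)] 1(7)])
    finally show ?thesis
      by (simp add: 1(1,2))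
  qed
  from lift_class [OF rep, of ?F, OF this] show ?thesis
    by (simp add: twice_def)
qed

end

end

theory Submission
  imports Defs
begin

text \<open>
  Writing \<open>l = [l\<^sub>1, l\<^sub>2]\<close> and applying the co-Yoneda lemma to both residuals identifies a class
  \<open>\<langle>l | c | r\<rangle>\<close> with a triple of morphisms \<open>S \<rightarrow> A\<close>, \<open>S \<times> A \<rightarrow> A\<close> and \<open>S \<times> A \<times> A \<rightarrow> S\<close>.
  For the optic of a lens, equality of the last two components of \<open>once\<close> and \<open>twice\<close> is
  PutGet and PutPut. Conversely, by PutGet, \<open>Put ; [id, Get] = [id, \<pi>\<^sub>2] ; (Put \<times> A)\<close>; sliding
  \<open>Put \<times> A\<close> to the right, replacing it by \<open>\<pi>\<^sub>1 \<times> A\<close> with PutPut and sliding back turns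
  \<open>twice\<close> into \<open>once\<close>.
\<close>

context finite_product_category
begin

lemma pair_unique:
  assumes "h \<in> hom C X (Y \<otimes> Z)" "Y \<in> Obj C" "Z \<in> Obj C"
    and "h \<Zsemi> proj1 C Y Z = f" "h \<Zsemi> proj2 C Y Z = g"
  shows "h = pair C f g"
proof -
  have f: "f \<in> hom C X Y"
    using seq_hom [OF assms(1) proj1_hom [OF assms(2,3)]] assms(4) by simp
  have g: "g \<in> hom C X Z"
    using seq_hom [OF assms(1) proj2_hom [OF assms(2,3)]] assms(5) by simp
  show ?thesis
    using prod_universal [OF f g] pair_props [OF f g] assms by blast
qed

lemma seq_pair:
  assumes "h \<in> hom C W X" "f \<in> hom C X Y" "g \<in> hom C X Z"
  shows "h \<Zsemi> pair C f g = pair C (h \<Zsemi> f) (h \<Zsemi> g)"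
proof -
  note ob = hom_Obj(2) [OF assms(2)] hom_Obj(2) [OF assms(3)]
  note p = pair_props [OF assms(2,3)]
  show ?thesis
    by (rule pair_unique [OF seq_hom [OF assms(1) p(1)] ob])
      (simp_all add: p seq_assoc [OF assms(1) p(1) proj1_hom [OF ob]]
        seq_assoc [OF assms(1) p(1) proj2_hom [OF ob]])
qed

lemma act_eq_pair:
  assumes "\<phi> \<in> hom C M N" "A \<in> Obj C"
  shows "act C \<phi> A = pair C (proj1 C M A \<Zsemi> \<phi>) (proj2 C M A)"
proof -
  note M = hom_Obj(1) [OF assms(1)]
  have "src C \<phi> = M" "src C (ident C A) = A"
    using assms ident_hom [of A] by (auto simp: hom_def)
  then show ?thesis
    unfolding act_def prod_arr_def by (simp add: seq_ident [OF proj2_hom [OF M assms(2)]])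
qed

lemma act_proj:
  assumes "\<phi> \<in> hom C M N" "A \<in> Obj C"
  shows "act C \<phi> A \<Zsemi> proj1 C N A = proj1 C M A \<Zsemi> \<phi>"
    and "act C \<phi> A \<Zsemi> proj2 C N A = proj2 C M A"
proof -
  note M = hom_Obj(1) [OF assms(1)]
  note p = pair_props [OF seq_hom [OF proj1_hom [OF M assms(2)] assms(1)]
      proj2_hom [OF M assms(2)]]
  show "act C \<phi> A \<Zsemi> proj1 C N A = proj1 C M A \<Zsemi> \<phi>"
    and "act C \<phi> A \<Zsemi> proj2 C N A = proj2 C M A"
    by (simp_all add: act_eq_pair [OF assms] p)
qed

lemma seq_act_proj:
  assumes "h \<in> hom C X (M \<otimes> A)" "\<phi> \<in> hom C M N" "A \<in> Obj C"
  shows "(h \<Zsemi> act C \<phi> A) \<Zsemi> proj1 C N A = (h \<Zsemi> proj1 C M A) \<Zsemi> \<phi>"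
    and "(h \<Zsemi> act C \<phi> A) \<Zsemi> proj2 C N A = h \<Zsemi> proj2 C M A"
proof -
  note ob = hom_Obj [OF assms(2)]
  note a = act_hom [OF assms(2,3)]
  show "(h \<Zsemi> act C \<phi> A) \<Zsemi> proj1 C N A = (h \<Zsemi> proj1 C M A) \<Zsemi> \<phi>"
    using seq_assoc [OF assms(1) a proj1_hom [OF ob(2) assms(3)]]
      seq_assoc [OF assms(1) proj1_hom [OF ob(1) assms(3)] assms(2)]
    by (simp add: act_proj [OF assms(2,3)])
  show "(h \<Zsemi> act C \<phi> A) \<Zsemi> proj2 C N A = h \<Zsemi> proj2 C M A"
    using seq_assoc [OF assms(1) a proj2_hom [OF ob(2) assms(3)]]
    by (simp add: act_proj [OF assms(2,3)])
qed

text \<open>Read from right to left, this splits the end of a first component off as a factor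
  \<open>act C \<phi> A\<close>, the form in which it can be slid.\<close>

lemma pair_act:
  assumes "f \<in> hom C X M" "g \<in> hom C X A" "\<phi> \<in> hom C M N"
  shows "pair C f g \<Zsemi> act C \<phi> A = pair C (f \<Zsemi> \<phi>) g"
proof -
  note ob = hom_Obj(2) [OF assms(3)] hom_Obj(2) [OF assms(2)]
  note p = pair_props [OF assms(1,2)]
  show ?thesis
    by (rule pair_unique [OF seq_hom [OF p(1) act_hom [OF assms(3) ob(2)]] ob])
      (simp_all add: seq_act_proj [OF p(1) assms(3) ob(2)] p)
qed

lemma act_seq:
  assumes "\<phi> \<in> hom C L M" "\<psi> \<in> hom C M N" "A \<in> Obj C"
  shows "act C (\<phi> \<Zsemi> \<psi>) A = act C \<phi> A \<Zsemi> act C \<psi> A"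
proof -
  note L = hom_Obj(1) [OF assms(1)]
  note p = proj1_hom [OF L assms(3)] proj2_hom [OF L assms(3)]
  show ?thesis
    using pair_act [OF seq_hom [OF p(1) assms(1)] p(2) assms(2)]
    by (simp add: act_eq_pair [OF assms(1,3)] act_eq_pair [OF seq_hom [OF assms(1,2)] assms(3)]
        seq_assoc [OF p(1) assms(1,2)])
qed

lemma pair_proj:
  assumes "Y \<in> Obj C" "Z \<in> Obj C"
  shows "pair C (proj1 C Y Z) (proj2 C Y Z) = ident C (Y \<otimes> Z)"
  by (rule pair_unique [OF ident_hom [OF prod_Obj [OF assms]] assms, symmetric])
    (simp_all add: ident_seq [OF proj1_hom [OF assms]] ident_seq [OF proj2_hom [OF assms]])

lemma act_ident:
  assumes "M \<in> Obj C" "A \<in> Obj C"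
  shows "act C (ident C M) A = ident C (M \<otimes> A)"
  by (simp add: act_eq_pair [OF ident_hom [OF assms(1)] assms(2)]
      seq_ident [OF proj1_hom [OF assms]] pair_proj [OF assms])

text \<open>Since \<open>l = [id, l\<^sub>2] \<Zsemi> act C l\<^sub>1 A\<close>, the arrow
  \<open>l\<^sub>1\<close> can be slid rightwards into \<open>c\<close>, which makes
  \<open>S\<close> the left residual. This is the middle arrow that results.\<close>

definition middle :: "'o \<Rightarrow> 'o \<Rightarrow> 'm \<Rightarrow> 'm \<Rightarrow> 'm" where
  "middle A M l c = act C (l \<Zsemi> proj1 C M A) A \<Zsemi> c"

lemma middle_hom:
  assumes "A \<in> Obj C" "M \<in> Obj C" "l \<in> hom C S (M \<otimes> A)" "c \<in> hom C (M \<otimes> A) Z"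
  shows "middle A M l c \<in> hom C (S \<otimes> A) Z"
  unfolding middle_def
  by (rule seq_hom [OF act_hom [OF seq_hom [OF assms(3) proj1_hom [OF assms(2,1)]] assms(1)] assms(4)])

lemma middle_slide:
  assumes "A \<in> Obj C" "\<phi> \<in> hom C M N" "l \<in> hom C S (M \<otimes> A)" "c \<in> hom C (N \<otimes> A) Z"
  shows "middle A N (l \<Zsemi> act C \<phi> A) c = middle A M l (act C \<phi> A \<Zsemi> c)"
proof -
  note l1 = seq_hom [OF assms(3) proj1_hom [OF hom_Obj(1) [OF assms(2)] assms(1)]]
  show ?thesis
    by (simp add: middle_def seq_act_proj(1) [OF assms(3,2,1)] act_seq [OF l1 assms(2,1)]
        seq_assoc [OF act_hom [OF l1 assms(1)] act_hom [OF assms(2,1)] assms(4)])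
qed

text \<open>These are the last two of the three co-Yoneda components: the part of
  \<open>middle\<close> with values in \<open>A\<close>, and \<open>r\<close> after its part with
  values in \<open>M2\<close> has been slid into it. The first,
  \<open>l \<Zsemi> proj2 C M1 A\<close>, is left out, because once and twice have the same
  \<open>l\<close>.\<close>

definition optic2_inv :: "'o \<Rightarrow> 'o \<times> 'o \<times> 'm \<times> 'm \<times> 'm \<Rightarrow> 'm \<times> 'm" where
  "optic2_inv A = (\<lambda>(M1, M2, l, c, r).
     (middle A M1 l c \<Zsemi> proj2 C M2 A, act C (middle A M1 l c \<Zsemi> proj1 C M2 A) A \<Zsemi> r))"

text \<open>A left slide does not change \<open>middle\<close>. A right slide composes
  \<open>middle\<close> with \<open>act C \<phi> A\<close>: this keeps its second component and
  appends \<open>\<phi>\<close> to its first, and functoriality of \<open>act\<close> passes that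
  \<open>\<phi>\<close> on to \<open>r\<close>.\<close>

lemma optic2_inv_step:
  assumes A: "A \<in> Obj C" and "optic2_step C S A x y"
  shows "optic2_inv A x = optic2_inv A y"
  using assms(2)
proof cases
  case (slide_left M1 N1 M2 \<phi> l c r)
  then show ?thesis
    by (simp add: optic2_inv_def middle_slide [OF A])
next
  case (slide_right M1 M2 N2 \<phi> l c r)
  have mid: "middle A M1 l (c \<Zsemi> act C \<phi> A) = middle A M1 l c \<Zsemi> act C \<phi> A"
    unfolding middle_def
    by (rule seq_assoc [OF act_hom [OF seq_hom [OF slide_right(7) proj1_hom [OF slide_right(3) A]] A]
          slide_right(8) act_hom [OF slide_right(6) A], symmetric])
  note m = middle_hom [OF A slide_right(3,7,8)]
  note m1 = seq_hom [OF m proj1_hom [OF slide_right(4) A]]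
  show ?thesis
    by (simp add: slide_right(1,2) optic2_inv_def mid seq_act_proj [OF m slide_right(6) A]
        act_seq [OF m1 slide_right(6) A]
        seq_assoc [OF act_hom [OF m1 A] act_hom [OF slide_right(6) A] slide_right(9)])
qed

lemma optic2_inv_cong:
  assumes A: "A \<in> Obj C"
    and rep: "(N1, N2, l', c', r') \<in> optic2_reps C S A"
    and eq: "optic2 C S A M1 M2 l c r = optic2 C S A N1 N2 l' c' r'"
  shows "optic2_inv A (M1, M2, l, c, r) = optic2_inv A (N1, N2, l', c', r')"
proof -
  have "equivclp (optic2_step C S A) (M1, M2, l, c, r) (N1, N2, l', c', r')"
    using eq_equiv_class [OF eq [unfolded optic2_def] equiv_optic2_rel rep]
    by (simp add: optic2_rel_def)
  then show ?thesis
  proof (induction rule: equivclp_induct)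
    case (step y z)
    then show ?case
      using optic2_inv_step [OF A] by metis
  qed simp
qed

lemma lens_once_eq_twice_iff:
  assumes S: "S \<in> Obj C" and A: "A \<in> Obj C"
    and get: "Get \<in> hom C S A" and put: "Put \<in> hom C (S \<otimes> A) S"
  defines "l \<equiv> pair C (ident C S) Get"
  shows "optic2 C S A S S l (ident C (S \<otimes> A)) Put = optic2 C S A S S l (Put \<Zsemi> l) Put \<longleftrightarrow>
      Put \<Zsemi> Get = proj2 C S A \<and> act C Put A \<Zsemi> Put = act C (proj1 C S A) A \<Zsemi> Put"
    (is "?once = ?twice \<longleftrightarrow> ?PutGet \<and> ?PutPut")
proof
  note SA = prod_Obj [OF S A]
  note p1 = proj1_hom [OF S A] and p2 = proj2_hom [OF S A]
  note l = pair_props [OF ident_hom [OF S] get, folded l_def]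
  note pl = seq_hom [OF put l(1)]
  {
    \<comment> \<open>The first component of \<open>l\<close> is the identity, so nothing is slid
      into \<open>c\<close>.\<close>
    have mid: "middle A S l c = c" if "c \<in> hom C (S \<otimes> A) Z" for c Z
      by (simp add: middle_def l act_ident [OF S A] ident_seq [OF that])
    have proj: "(Put \<Zsemi> l) \<Zsemi> proj1 C S A = Put" "(Put \<Zsemi> l) \<Zsemi> proj2 C S A = Put \<Zsemi> Get"
      using seq_assoc [OF put l(1) p1] seq_assoc [OF put l(1) p2] seq_ident [OF put]
      by (simp_all add: l)
    assume "?once = ?twice"
    moreover have "(S, S, l, Put \<Zsemi> l, Put) \<in> optic2_reps C S A"
      using S l(1) pl put by (simp add: optic2_reps_def)
    ultimately have "optic2_inv A (S, S, l, ident C (S \<otimes> A), Put)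
        = optic2_inv A (S, S, l, Put \<Zsemi> l, Put)"
      using optic2_inv_cong [OF A] by blast
    \<comment> \<open>For once the invariant is \<open>\<pi>\<^sub>2\<close> with
      \<open>act C \<pi>\<^sub>1 A \<Zsemi> Put\<close>; for twice it is
      \<open>Put \<Zsemi> Get\<close> with \<open>act C Put A \<Zsemi> Put\<close>.\<close>
    then show "?PutGet \<and> ?PutPut"
      by (simp add: optic2_inv_def mid [OF ident_hom [OF SA]] mid [OF pl] proj
          ident_seq [OF p1] ident_seq [OF p2])
  next
    assume laws: "?PutGet \<and> ?PutPut"
    \<comment> \<open>Copying the \<open>A\<close> factor enlarges the right residual to
      \<open>S \<otimes> A\<close>, so that every \<open>[\<phi>, \<pi>\<^sub>2]\<close> factors as
      \<open>?d \<Zsemi> act C \<phi> A\<close> and \<open>\<phi>\<close> can be slid into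
      \<open>Put\<close>.\<close>
    let ?d = "pair C (ident C (S \<otimes> A)) (proj2 C S A)"
    note d = pair_props(1) [OF ident_hom [OF SA] p2]
    have slide: "optic2 C S A S S l (pair C \<phi> (proj2 C S A)) Put
        = optic2 C S A S (S \<otimes> A) l ?d (act C \<phi> A \<Zsemi> Put)" if "\<phi> \<in> hom C (S \<otimes> A) S" for \<phi>
      using optic2_slide_right [OF A that S l(1) d put]
      by (simp add: pair_act [OF ident_hom [OF SA] p2 that] ident_seq [OF that])
    have "Put \<Zsemi> l = pair C Put (proj2 C S A)"
      using laws by (simp add: l_def seq_pair [OF put ident_hom [OF S] get] seq_ident [OF put])
    then have "?twice = optic2 C S A S (S \<otimes> A) l ?d (act C Put A \<Zsemi> Put)"
      by (simp add: slide [OF put])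
    \<comment> \<open>PutPut exchanges \<open>Put\<close> for \<open>\<pi>\<^sub>1\<close> under
      \<open>act\<close>, and \<open>slide\<close> is then used backwards at
      \<open>\<phi> = \<pi>\<^sub>1\<close>.\<close>
    also have "\<dots> = optic2 C S A S S l (pair C (proj1 C S A) (proj2 C S A)) Put"
      using laws by (simp add: slide [OF p1])
    finally show "?once = ?twice"
      by (simp add: pair_proj [OF S A])
  }
qed

end

theorem proposition3p0p3:
  fixes C :: "('o, 'm) fp_category" (structure)
    and S A :: 'o and Get Put :: 'm
  assumes "finite_product_category C"
    and "S \<in> Obj C" and "A \<in> Obj C"
    and "Get \<in> hom C S A" and "Put \<in> hom C (S \<otimes> A) S"
  shows "lawful_optic C S A (lens_optic C S A Get Put) \<longleftrightarrow>
      Put \<Zsemi> Get = proj2 C S A \<and>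
      pair C (ident C S) Get \<Zsemi> Put = ident C S \<and>
      prod_arr C Put (ident C A) \<Zsemi> Put =
        pair C (proj1 C (S \<otimes> A) A \<Zsemi> proj1 C S A) (proj2 C (S \<otimes> A) A) \<Zsemi> Put"
proof -
  interpret finite_product_category C by (rule assms(1))
  note S = assms(2) and A = assms(3) and get = assms(4) and put = assms(5)
  let ?l = "pair C (ident C S) Get"
  have rep: "(S, ?l, Put) \<in> optic_reps C S A"
    using S put pair_props(1) [OF ident_hom [OF S] get] by (simp add: optic_reps_def)
  \<comment> \<open>With triple products bracketed to the left,
    \<open>\<pi>\<^sub>1\<^sub>,\<^sub>3\<close> is the action of
    \<open>\<pi>\<^sub>1\<close>.\<close>
  have pp: "act C (proj1 C S A) A
      = pair C (proj1 C (S \<otimes> A) A \<Zsemi> proj1 C S A) (proj2 C (S \<otimes> A) A)"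
    by (rule act_eq_pair [OF proj1_hom [OF S A] A])
  show ?thesis
    using lens_once_eq_twice_iff [OF S A get put]
    by (auto simp: lawful_optic_def lens_optic_def optic_in_Optic [OF rep] outside_optic [OF A rep]
        once_optic [OF A rep] twice_optic [OF A rep] pp act_def [of C Put])
qed

end
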